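(* Let $k\in\mathbb{N}^+$ and $t,s,\varepsilon\in\mathbb{R}^+$. If the graph $G=(V,E)$ with balanced $k$-partition $V_1\cup\cdots\cup V_k=V$ is $(k,t,s,\varepsilon)$-clique-dense, then every regular resolution refutation of the CNF formula $\mathrm{Clique}_{\mathrm{block}}(G,k)$ has length at least $\Omega\big(s^{\varepsilon k/t^2}\big)$.
   Context: For $R\subseteq V$, $N(R)=\bigcap_{v\in R}N(v)$ is the set of common neighbours of $R$, and $N_W(R)=N(R)\cap W$. For $q,r\in\mathbb{R}^+$, a set $W\subseteq V$ is $q$-neighbour-dense for $R\subseteq V$ if $|N_W(R)|\ge q$; $W$ is $(r,q)$-neighbour-dense if it is $q$-neighbour-dense for every $R\subseteq V$ with $|R|\le r$. For $r'\ge r$ and $q,s\in\mathbb{R}^+$, $W$ is $(r',r,q,s)$-mostly neighbour-dense if there is $S\subseteq V$ with $|S|\le s$ such that every $R\subseteq V$ with $|R|\le r'$ for which $W$ is not $q$-neighbour-dense for $R$ satisfies $|R\cap S|\ge r$. For $k\in\mathbb{N}^+$ and $t,s,\varepsilon\in\mathbb{R}^+$ with $1\le t\le k$, a graph $G$ with $k$-partition $V_1\cup\cdots\cup V_k$ is $(k,t,s,\varepsilon)$-clique-dense if there exist $r,q\in\mathbb{R}^+$ with $r\ge 4k/t^2$ such that (1) each $V_i$ is $(tr,tq)$-neighbour-dense, and (2) every $(r,q)$-neighbour-dense set $W\subseteq V$ is $(tr,r,q',s)$-mostly neighbour-dense for $q'=\varepsilon r s^{1+\varepsilon}\log s$ (natural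 log). A $k$-partition is balanced if $|V_i|\le|V_j|+1$ for all $i,j$. $\mathrm{Clique}_{\mathrm{block}}(G,k)$ is the CNF over variables $x_v$ ($v\in V$) with clauses $\neg x_u\vee\neg x_v$ for distinct $u,v$ with $\{u,v\}\notin E$; $\bigvee_{v\in V_i}x_v$ for $i\in[k]$; and $\neg x_u\vee\neg x_v$ for $i\in[k]$ and distinct $u,v\in V_i$. A resolution refutation is a sequence of clauses, each initial or derived by $B\vee x,\ C\vee\neg x\vdash B\vee C$, ending in the empty clause; its length is its number of clauses; it is regular if no variable is resolved on more than once along any source-to-sink path of its DAG. *)

theory Defs
  imports Complex_Main "HOL-Library.Disjoint_Sets"
begin

definition simple_graph :: "'a set \<Rightarrow> 'a set set \<Rightarrow> bool" where
  "simple_graph V E \<longleftrightarrow> finite V \<and> (\<forall>e\<in>E. \<exists>u\<in>V. \<exists>v\<in>V. u \<noteq> v \<and> e = {u, v})"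

(* Blocks are indexed by 1..k; edges inside a block are not excluded. *)
definition k_partition :: "nat \<Rightarrow> 'a set \<Rightarrow> (nat \<Rightarrow> 'a set) \<Rightarrow> bool" where
  "k_partition k V P \<longleftrightarrow> (\<Union>i\<in>{1..k}. P i) = V \<and> disjoint_family_on P {1..k}"

definition balanced :: "nat \<Rightarrow> (nat \<Rightarrow> 'a set) \<Rightarrow> bool" where
  "balanced k P \<longleftrightarrow> (\<forall>i\<in>{1..k}. \<forall>j\<in>{1..k}. card (P i) \<le> card (P j) + 1)"

definition nbh :: "'a set \<Rightarrow> 'a set set \<Rightarrow> 'a \<Rightarrow> 'a set" where
  "nbh V E v = {w \<in> V. {v, w} \<in> E}"

(* The intersection is taken inside V, so the empty set has all of V as common neighbours. *)
definition common_nbh :: "'a set \<Rightarrow> 'a set set \<Rightarrow> 'a set \<Rightarrow> 'a set" where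
  "common_nbh V E R = V \<inter> (\<Inter>v\<in>R. nbh V E v)"

definition nbh_dense_for :: "'a set \<Rightarrow> 'a set set \<Rightarrow> real \<Rightarrow> 'a set \<Rightarrow> 'a set \<Rightarrow> bool" where
  "nbh_dense_for V E q W R \<longleftrightarrow> q \<le> real (card (common_nbh V E R \<inter> W))"

definition nbh_dense :: "'a set \<Rightarrow> 'a set set \<Rightarrow> real \<Rightarrow> real \<Rightarrow> 'a set \<Rightarrow> bool" where
  "nbh_dense V E r q W \<longleftrightarrow> (\<forall>R\<subseteq>V. real (card R) \<le> r \<longrightarrow> nbh_dense_for V E q W R)"

definition mostly_nbh_dense ::
    "'a set \<Rightarrow> 'a set set \<Rightarrow> real \<Rightarrow> real \<Rightarrow> real \<Rightarrow> real \<Rightarrow> 'a set \<Rightarrow> bool" where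
  "mostly_nbh_dense V E r' r q s W \<longleftrightarrow>
     (\<exists>S\<subseteq>V. real (card S) \<le> s \<and>
        (\<forall>R\<subseteq>V. real (card R) \<le> r' \<and> \<not> nbh_dense_for V E q W R \<longrightarrow> r \<le> real (card (R \<inter> S))))"

definition clique_dense ::
    "nat \<Rightarrow> real \<Rightarrow> real \<Rightarrow> real \<Rightarrow> 'a set \<Rightarrow> 'a set set \<Rightarrow> (nat \<Rightarrow> 'a set) \<Rightarrow> bool" where
  "clique_dense k t s \<epsilon> V E P \<longleftrightarrow>
     1 \<le> t \<and> t \<le> real k \<and>
     (\<exists>r q. 0 < r \<and> 0 < q \<and> 4 * real k / t\<^sup>2 \<le> r \<and>
        (\<forall>i\<in>{1..k}. nbh_dense V E (t * r) (t * q) (P i)) \<and>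
        (\<forall>W\<subseteq>V. nbh_dense V E r q W \<longrightarrow>
           mostly_nbh_dense V E (t * r) r (\<epsilon> * r * s powr (1 + \<epsilon>) * ln s) s W))"

datatype 'v literal = Pos 'v | Neg 'v

type_synonym 'v clause = "'v literal set"

(* The vertex v itself serves as the name of the variable x_v. *)
definition Clique_block ::
    "nat \<Rightarrow> 'a set \<Rightarrow> 'a set set \<Rightarrow> (nat \<Rightarrow> 'a set) \<Rightarrow> 'a clause set" where
  "Clique_block k V E P =
     {{Neg u, Neg v} | u v. u \<in> V \<and> v \<in> V \<and> u \<noteq> v \<and> {u, v} \<notin> E} \<union>
     {Pos ` P i | i. i \<in> {1..k}} \<union>
     {{Neg u, Neg v} | u v i. i \<in> {1..k} \<and> u \<in> P i \<and> v \<in> P i \<and> u \<noteq> v}"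

(* A clause of a refutation carries its justification, so that the DAG of the refutation is
   determined: Resolve i j x resolves lines i and j on the variable x, which occurs positively
   in line i and negatively in line j. *)
datatype 'v justification = Initial | Resolve nat nat 'v

type_synonym 'v derivation = "('v clause \<times> 'v justification) list"

definition is_resolvent :: "'v \<Rightarrow> 'v clause \<Rightarrow> 'v clause \<Rightarrow> 'v clause \<Rightarrow> bool" where
  "is_resolvent x A A' D \<longleftrightarrow>
     (\<exists>B C. Pos x \<notin> B \<and> Neg x \<notin> C \<and> A = insert (Pos x) B \<and> A' = insert (Neg x) C \<and> D = B \<union> C)"

definition resolution_refutation :: "'v clause set \<Rightarrow> 'v derivation \<Rightarrow> bool" where
  "resolution_refutation F \<pi> \<longleftrightarrow>
     \<pi> \<noteq> [] \<and> fst (last \<pi>) = {} \<and>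
     (\<forall>m<length \<pi>. case snd (\<pi> ! m) of
         Initial \<Rightarrow> fst (\<pi> ! m) \<in> F
       | Resolve i j x \<Rightarrow> i < m \<and> j < m \<and>
           is_resolvent x (fst (\<pi> ! i)) (fst (\<pi> ! j)) (fst (\<pi> ! m)))"

(* Edges of the DAG lead from premises to conclusions. *)
definition dag_edge :: "'v derivation \<Rightarrow> nat \<Rightarrow> nat \<Rightarrow> bool" where
  "dag_edge \<pi> l m \<longleftrightarrow>
     m < length \<pi> \<and> (\<exists>i j x. snd (\<pi> ! m) = Resolve i j x \<and> (l = i \<or> l = j))"

definition dag_source :: "'v derivation \<Rightarrow> nat \<Rightarrow> bool" where
  "dag_source \<pi> m \<longleftrightarrow> m < length \<pi> \<and> (\<forall>l. \<not> dag_edge \<pi> l m)"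

definition dag_sink :: "'v derivation \<Rightarrow> nat \<Rightarrow> bool" where
  "dag_sink \<pi> m \<longleftrightarrow> m < length \<pi> \<and> (\<forall>l. \<not> dag_edge \<pi> m l)"

definition source_sink_path :: "'v derivation \<Rightarrow> nat list \<Rightarrow> bool" where
  "source_sink_path \<pi> p \<longleftrightarrow>
     p \<noteq> [] \<and> successively (dag_edge \<pi>) p \<and> dag_source \<pi> (hd p) \<and> dag_sink \<pi> (last p)"

definition resolved_vars :: "'v derivation \<Rightarrow> nat list \<Rightarrow> 'v list" where
  "resolved_vars \<pi> p =
     concat (map (\<lambda>m. case snd (\<pi> ! m) of Initial \<Rightarrow> [] | Resolve i j x \<Rightarrow> [x]) p)"

definition regular :: "'v derivation \<Rightarrow> bool" where
  "regular \<pi> \<longleftrightarrow> (\<forall>p. source_sink_path \<pi> p \<longrightarrow> distinct (resolved_vars \<pi> p))"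

end

theory Submission imports Defs begin

text \<open>
  Read from the empty clause towards the initial clauses, a regular refutation is a read-once
  branching program. Walk down it, answering the query of a vertex by 1 with probability
  \<open>\<gamma> = s powr - (1 + \<epsilon>)\<close> if the vertex is a common neighbour of the vertices which every path to
  the current node sets to 1 and its block has no 1 so far, and by 0 otherwise. Such a walk can only
  end by setting an entire block \<open>P i\<close> to 0. Cut it into \<open>\<lfloor>t\<rfloor>\<close> pieces with less than \<open>k / \<lfloor>t\<rfloor>\<close>
  ones each; as \<open>P i\<close> is \<open>(t * r, t * q)\<close>-neighbour-dense, between the end points \<open>a\<close>, \<open>b\<close> of some
  piece an \<open>(r, q)\<close>-neighbour-dense part of \<open>P i\<close> is set to 0. For a fixed pair \<open>(a, b)\<close> this is
  unlikely: either more than \<open>t * r / 2\<close> ones are prescribed at \<open>a\<close>, or at least \<open>r\<close> vertices of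
  the small exceptional set \<open>S\<close> are set to 1, or very many free answers are all 0. A union
  bound over the pairs of nodes then bounds the square of the length from below.

  The argument is derandomised: conditional probabilities are replaced by supermartingales, and
  one follows a walk along which their sum stays below 1.
\<close>

section \<open>Runs of a refutation and the values they force\<close>

type_synonym 'v query = "nat \<times> 'v \<times> bool"

definition assigned :: "bool \<Rightarrow> 'v query list \<Rightarrow> 'v set" where
  "assigned z h = {x. \<exists>m. (m, x, z) \<in> set h}"

text \<open>
  A query \<open>(m, x, z)\<close> answers the variable resolved on at line \<open>m\<close> by \<open>z\<close>; the run continues at
  the premise whose literal of \<open>x\<close> is falsified, against the direction of \<^const>\<open>dag_edge\<close>.
\<close>

fun run :: "'v derivation \<Rightarrow> nat \<Rightarrow> 'v query list \<Rightarrow> nat \<Rightarrow> bool" where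
  "run \<pi> a [] b \<longleftrightarrow> a = b"
| "run \<pi> a ((m, x, z) # h) b \<longleftrightarrow>
     m = a \<and> (\<exists>i j. snd (\<pi> ! a) = Resolve i j x \<and> run \<pi> (if z then j else i) h b)"

text \<open>If \<open>a\<close> is not reachable from the empty clause, then \<open>forced \<pi> z a\<close> is \<open>UNIV\<close>.\<close>

definition forced :: "'v derivation \<Rightarrow> bool \<Rightarrow> nat \<Rightarrow> 'v set" where
  "forced \<pi> z a = {x. \<forall>h. run \<pi> (length \<pi> - 1) h a \<longrightarrow> x \<in> assigned z h}"

lemma assigned_Nil [simp]: "assigned z [] = {}"
  by (simp add: assigned_def)

lemma assigned_Cons [simp]:
  "assigned z ((m, x, y) # h) = (if y = z then insert x (assigned z h) else assigned z h)"
  by (auto simp: assigned_def)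

lemma assigned_append [simp]: "assigned z (g @ h) = assigned z g \<union> assigned z h"
  by (auto simp: assigned_def)

lemma finite_assigned [simp]: "finite (assigned z h)"
  by (induction h) auto

lemma assigned_subset_vars: "assigned z h \<subseteq> set (map (fst \<circ> snd) h)"
  by (force simp: assigned_def)

lemma run_append: "run \<pi> a (g @ h) b \<longleftrightarrow> (\<exists>c. run \<pi> a g c \<and> run \<pi> c h b)"
proof (induction g arbitrary: a)
  case (Cons e g)
  then show ?case by (cases e) (simp, blast)
qed simp

lemma forcedD: "x \<in> forced \<pi> z a \<Longrightarrow> run \<pi> (length \<pi> - 1) h a \<Longrightarrow> x \<in> assigned z h"
  by (simp add: forced_def)

section \<open>Regular refutations as read-once branching programs\<close>

locale regular_refutation =
  fixes F :: "'v clause set" and \<pi> :: "'v derivation"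
  assumes refutation: "resolution_refutation F \<pi>"
    and regular: "regular \<pi>"
begin

abbreviation root :: nat where "root \<equiv> length \<pi> - 1"

lemma length_pos: "0 < length \<pi>"
  using refutation by (simp add: resolution_refutation_def)

lemma root_less: "root < length \<pi>"
  using length_pos by simp

lemma root_clause: "fst (\<pi> ! root) = {}"
  using refutation last_conv_nth[of \<pi>] by (simp add: resolution_refutation_def)

lemma initialD: "m < length \<pi> \<Longrightarrow> snd (\<pi> ! m) = Initial \<Longrightarrow> fst (\<pi> ! m) \<in> F"
  using refutation by (force simp: resolution_refutation_def)

lemma resolveD:
  assumes "m < length \<pi>" "snd (\<pi> ! m) = Resolve i j x"
  shows "i < m" "j < m" "is_resolvent x (fst (\<pi> ! i)) (fst (\<pi> ! j)) (fst (\<pi> ! m))"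
  using refutation assms by (force simp: resolution_refutation_def)+

lemma run_le: "a < length \<pi> \<Longrightarrow> run \<pi> a h b \<Longrightarrow> b \<le> a"
proof (induction h arbitrary: a)
  case (Cons e h)
  obtain m x z where e: "e = (m, x, z)" by (cases e)
  with Cons.prems obtain i j where ij: "snd (\<pi> ! a) = Resolve i j x"
    "run \<pi> (if z then j else i) h b" by auto
  from resolveD[OF Cons.prems(1) ij(1)] have "(if z then j else i) < a" by simp
  with Cons.IH[OF _ ij(2)] Cons.prems(1) show ?case by linarith
qed simp

lemma run_root_less: "run \<pi> root h b \<Longrightarrow> b < length \<pi>"
  using run_le[OF root_less] root_less by fastforce

text \<open>Runs go from conclusions to premises, against \<open>dag_edge\<close>, hence the
  reversal. The end node \<open>b\<close> is left out of \<open>resolved_vars\<close> because the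
  run stops before querying its variable.\<close>

lemma run_path:
  assumes "a < length \<pi>" "run \<pi> a h b"
  shows "successively (dag_edge \<pi>) (b # rev (map fst h)) \<and> last (b # rev (map fst h)) = a
    \<and> resolved_vars \<pi> (rev (map fst h)) = rev (map (fst \<circ> snd) h)"
  using assms
proof (induction h arbitrary: a)
  case Nil
  then show ?case by (simp add: resolved_vars_def)
next
  case (Cons e h)
  obtain m x z where e: "e = (m, x, z)" by (cases e)
  with Cons.prems obtain i j where ij: "m = a" "snd (\<pi> ! a) = Resolve i j x"
    "run \<pi> (if z then j else i) h b" by auto
  let ?c = "if z then j else i"
  have less: "?c < length \<pi>" using resolveD[OF Cons.prems(1) ij(2)] Cons.prems(1) by simp
  note IH = Cons.IH[OF less ij(3)]
  have edge: "dag_edge \<pi> ?c a" using Cons.prems(1) ij(2) by (auto simp: dag_edge_def)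
  have "successively (dag_edge \<pi>) ((b # rev (map fst h)) @ [a])"
    using IH edge unfolding successively_append_iff by simp
  moreover have "resolved_vars \<pi> (rev (map fst h) @ [a]) = rev (map (fst \<circ> snd) h) @ [x]"
    using IH ij(2) by (simp add: resolved_vars_def)
  ultimately show ?case using e ij(1) by simp
qed

lemma run_to_initial:
  "m < length \<pi> \<Longrightarrow> \<exists>h b. run \<pi> m h b \<and> b < length \<pi> \<and> snd (\<pi> ! b) = Initial"
proof (induction m rule: less_induct)
  case (less m)
  show ?case
  proof (cases "snd (\<pi> ! m)")
    case Initial
    then show ?thesis using less.prems run.simps(1) by blast
  next
    case (Resolve i j x)
    with resolveD[OF less.prems Resolve] less.IH[of i] less.prems obtain h b
      where "run \<pi> i h b" "b < length \<pi>" "snd (\<pi> ! b) = Initial" by auto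
    then have "run \<pi> m ((m, x, False) # h) b" using Resolve by simp
    then show ?thesis using \<open>b < length \<pi>\<close> \<open>snd (\<pi> ! b) = Initial\<close> by blast
  qed
qed

text \<open>Regularity speaks only of complete source-to-sink paths, so the run is first prolonged
  from \<open>m\<close> to an initial clause.\<close>

lemma run_distinct:
  assumes "run \<pi> root h m"
  shows "distinct (map (fst \<circ> snd) h)"
proof -
  obtain g b where g: "run \<pi> m g b" "b < length \<pi>" "snd (\<pi> ! b) = Initial"
    using run_to_initial run_root_less[OF assms] by blast
  then have "run \<pi> root (h @ g) b" using assms run_append by blast
  note p = run_path[OF root_less this]
  let ?p = "b # rev (map fst (h @ g))"
  have "dag_source \<pi> b" using g by (simp add: dag_source_def dag_edge_def)
  moreover have "\<not> dag_edge \<pi> root l" for l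
  proof
    assume "dag_edge \<pi> root l"
    then obtain i j x where "l < length \<pi>" "snd (\<pi> ! l) = Resolve i j x" "root = i \<or> root = j"
      unfolding dag_edge_def by blast
    with resolveD[of l i j x] show False by linarith
  qed
  then have "dag_sink \<pi> root" using root_less by (simp add: dag_sink_def)
  ultimately have "source_sink_path \<pi> ?p"
    using p by (simp add: source_sink_path_def)
  then have "distinct (resolved_vars \<pi> ?p)" using regular by (simp add: regular_def)
  moreover have "resolved_vars \<pi> ?p = resolved_vars \<pi> (rev (map fst (h @ g)))"
    using g(3) by (simp add: resolved_vars_def)
  ultimately have "distinct (map (fst \<circ> snd) (h @ g))" using p by (metis distinct_rev)
  then show ?thesis by simp
qed

lemma run_assigned_disjoint:
  assumes "run \<pi> root (g @ h) m"
  shows "assigned y g \<inter> assigned z h = {}"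
proof -
  have "set (map (fst \<circ> snd) g) \<inter> set (map (fst \<circ> snd) h) = {}"
    using run_distinct[OF assms] unfolding map_append distinct_append by blast
  with assigned_subset_vars[of y g] assigned_subset_vars[of z h] show ?thesis by blast
qed

lemma run_consistent:
  assumes "run \<pi> root h m"
  shows "assigned True h \<inter> assigned False h = {}"
proof -
  have "y = z" if "(a, x, y) \<in> set h" "(b, x, z) \<in> set h" for a b x y z
  proof -
    have "inj_on (fst \<circ> snd) (set h)" using run_distinct[OF assms] by (simp add: distinct_map)
    then have "(a, x, y) = (b, x, z)" using that by (metis comp_apply fst_conv snd_conv inj_onD)
    then show ?thesis by simp
  qed
  then show ?thesis unfolding assigned_def by blast
qed

text \<open>The only literal that a premise has beyond the conclusion is the one resolved on, and
  the answer that leads to this premise falsifies it.\<close>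

lemma run_falsifies:
  assumes "run \<pi> root h m"
  shows "Pos x \<in> fst (\<pi> ! m) \<Longrightarrow> x \<in> assigned False h"
    and "Neg x \<in> fst (\<pi> ! m) \<Longrightarrow> x \<in> assigned True h"
proof -
  have "(Pos x \<in> fst (\<pi> ! m) \<longrightarrow> x \<in> assigned False h)
      \<and> (Neg x \<in> fst (\<pi> ! m) \<longrightarrow> x \<in> assigned True h)"
    using assms
  proof (induction h arbitrary: m rule: rev_induct)
    case Nil
    then show ?case using root_clause by auto
  next
    case (snoc e h)
    obtain c y z where e: "e = (c, y, z)" by (cases e)
    with snoc.prems obtain i j where c: "run \<pi> root h c"
      "snd (\<pi> ! c) = Resolve i j y" "m = (if z then j else i)" by (auto simp: run_append)
    have "is_resolvent y (fst (\<pi> ! i)) (fst (\<pi> ! j)) (fst (\<pi> ! c))"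
      using resolveD(3)[OF run_root_less[OF c(1)] c(2)] .
    then show ?case using snoc.IH[OF c(1)] e c(3)
      by (cases z) (auto simp: is_resolvent_def)
  qed
  then show "Pos x \<in> fst (\<pi> ! m) \<Longrightarrow> x \<in> assigned False h"
    and "Neg x \<in> fst (\<pi> ! m) \<Longrightarrow> x \<in> assigned True h" by blast+
qed

text \<open>Every run to \<open>a\<close> continues along \<open>h\<close> to \<open>b\<close>, so a
  value that is forced at \<open>b\<close> but not set by \<open>h\<close> must be set before
  \<open>a\<close>.\<close>

lemma forced_later:
  assumes "run \<pi> a h b" "x \<in> forced \<pi> z b"
  shows "x \<in> forced \<pi> z a \<or> x \<in> assigned z h"
proof (rule disjCI)
  assume "x \<notin> assigned z h"
  moreover have "x \<in> assigned z (g @ h)" if "run \<pi> root g a" for g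
    using that assms forcedD run_append by metis
  ultimately show "x \<in> forced \<pi> z a" by (auto simp: forced_def)
qed

end

section \<open>The walk and its supermartingales\<close>

locale clique_refutation =
  regular_refutation "Clique_block k V E P" \<pi>
  for k :: nat and V :: "'a set" and E P \<pi> +
  fixes \<gamma> :: real
  assumes graph: "simple_graph V E"
    and partition: "k_partition k V P"
    and \<gamma>_pos: "0 < \<gamma>" and \<gamma>_less: "\<gamma> < 1"
begin

text \<open>The neighbourhood condition refers to the ones forced at the node \<open>m\<close>, not
  to all ones of \<open>h\<close>. It is therefore independent of the route to \<open>m\<close>,
  which lets one potential serve all runs through a fixed pair of nodes.\<close>

definition free :: "'a query list \<Rightarrow> nat \<Rightarrow> 'a \<Rightarrow> bool" where
  "free h m x \<longleftrightarrow> x \<in> common_nbh V E (forced \<pi> True m) \<and>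
     (\<forall>i\<in>{1..k}. x \<in> P i \<longrightarrow> P i \<inter> assigned True h = {})"

definition legal :: "'a query list \<Rightarrow> bool" where
  "legal h \<longleftrightarrow> (\<forall>g m x g'. h = g @ (m, x, True) # g' \<longrightarrow> free g m x)"

definition supermartingale :: "('a query list \<Rightarrow> real) \<Rightarrow> bool" where
  "supermartingale G \<longleftrightarrow> (\<forall>h m x.
     if free h m x then (1 - \<gamma>) * G (h @ [(m, x, False)]) + \<gamma> * G (h @ [(m, x, True)]) \<le> G h
     else G (h @ [(m, x, False)]) \<le> G h)"

text \<open>
  \<open>hit B h\<close> bounds the probability, given the history \<open>h\<close>, that all of \<open>B\<close> gets the value 1;
  \<open>miss i W n h\<close> bounds the probability that \<open>n\<close> free queries in \<open>W\<close>, a part of \<open>P i\<close>, are made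
  while \<open>P i\<close> has no 1.
\<close>

definition hit :: "'a set \<Rightarrow> 'a query list \<Rightarrow> real" where
  "hit B h = (if B \<inter> assigned False h = {} then \<gamma> ^ card (B - assigned True h) else 0)"

definition miss :: "nat \<Rightarrow> 'a set \<Rightarrow> nat \<Rightarrow> 'a query list \<Rightarrow> real" where
  "miss i W n h = (if P i \<inter> assigned True h = {} then (1 - \<gamma>) ^ (n -
       length (filter (\<lambda>(m, x, z). x \<in> W \<and> x \<in> common_nbh V E (forced \<pi> True m)) h))
     else 0)"

lemma finite_V: "finite V"
  using graph by (simp add: simple_graph_def)

lemma block_subset: "i \<in> {1..k} \<Longrightarrow> P i \<subseteq> V"
  using partition by (auto simp: k_partition_def)

lemma vertex_block: "x \<in> V \<Longrightarrow> \<exists>i\<in>{1..k}. x \<in> P i"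
  using partition by (auto simp: k_partition_def)

lemma block_unique: "\<lbrakk>i \<in> {1..k}; j \<in> {1..k}; x \<in> P i; x \<in> P j\<rbrakk> \<Longrightarrow> i = j"
  using partition unfolding k_partition_def disjoint_family_on_def by blast

lemma legal_Nil [simp]: "legal []"
  by (simp add: legal_def)

lemma legal_snoc: "legal (h @ [(m, x, z)]) \<longleftrightarrow> legal h \<and> (z \<longrightarrow> free h m x)"
proof
  assume L: "legal (h @ [(m, x, z)])"
  have "free g m' x'" if "h = g @ (m', x', True) # g'" for g m' x' g'
    using L that unfolding legal_def by fastforce
  then show "legal h \<and> (z \<longrightarrow> free h m x)" using L unfolding legal_def by blast
next
  assume R: "legal h \<and> (z \<longrightarrow> free h m x)"
  have "free g m' x'" if eq: "h @ [(m, x, z)] = g @ (m', x', True) # g'" for g m' x' g'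
  proof (cases g' rule: rev_cases)
    case Nil
    then show ?thesis using eq R by simp
  next
    case (snoc ys y)
    then have "h = g @ (m', x', True) # ys" using eq by simp
    then show ?thesis using R by (simp add: legal_def)
  qed
  then show "legal (h @ [(m, x, z)])" by (simp add: legal_def)
qed

lemma legal_appendD: "legal (g @ h) \<Longrightarrow> legal g"
  by (induction h rule: rev_induct) (auto simp: legal_snoc simp flip: append_assoc)

lemma legal_ones: "legal h \<Longrightarrow> assigned True h \<subseteq> V"
proof (induction h rule: rev_induct)
  case (snoc e h)
  then show ?case
    by (cases e) (auto simp: legal_snoc free_def common_nbh_def split: if_splits)
qed simp

lemma legal_block_ones:
  "\<lbrakk>legal h; i \<in> {1..k}; x \<in> P i; y \<in> P i; x \<in> assigned True h; y \<in> assigned True h\<rbrakk>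
    \<Longrightarrow> x = y"
proof (induction h rule: rev_induct)
  case (snoc e h)
  then show ?case
    by (cases e) (auto simp: legal_snoc free_def split: if_splits)
qed simp

lemma hit_nonneg: "0 \<le> hit B h"
  using \<gamma>_pos by (simp add: hit_def)

lemma miss_nonneg: "0 \<le> miss i W n h"
  using \<gamma>_less by (simp add: miss_def)

lemma supermartingale_zero: "supermartingale (\<lambda>h. 0)"
  by (simp add: supermartingale_def)

lemma supermartingale_add:
  assumes "supermartingale G" "supermartingale H"
  shows "supermartingale (\<lambda>h. G h + H h)"
  unfolding supermartingale_def
proof (intro allI)
  fix h m x
  show "if free h m x then (1 - \<gamma>) * (G (h @ [(m, x, False)]) + H (h @ [(m, x, False)])) +
      \<gamma> * (G (h @ [(m, x, True)]) + H (h @ [(m, x, True)])) \<le> G h + H h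
    else G (h @ [(m, x, False)]) + H (h @ [(m, x, False)]) \<le> G h + H h"
    using assms[unfolded supermartingale_def, rule_format, of h m x]
    by (auto simp: distrib_left split: if_splits)
qed

lemma supermartingale_sum:
  "finite I \<Longrightarrow> (\<And>i. i \<in> I \<Longrightarrow> supermartingale (G i)) \<Longrightarrow>
    supermartingale (\<lambda>h. \<Sum>i\<in>I. G i h)"
  by (induction I rule: finite_induct) (auto intro: supermartingale_zero supermartingale_add)

text \<open>For a query in \<open>B\<close>, the answer 0 makes \<open>hit\<close> vanish, and the
  answer 1, of weight \<open>\<gamma>\<close>, removes at most one factor \<open>\<gamma>\<close>.
  Queries outside \<open>B\<close> leave it unchanged.\<close>

lemma supermartingale_hit:
  assumes "finite B"
  shows "supermartingale (hit B)"
  unfolding supermartingale_def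
proof (intro allI)
  fix h m x
  have mono: "hit B (h @ [(m, x, False)]) \<le> hit B h"
    using \<gamma>_pos by (simp add: hit_def)
  have "(1 - \<gamma>) * hit B (h @ [(m, x, False)]) + \<gamma> * hit B (h @ [(m, x, True)]) \<le> hit B h"
  proof (cases "x \<in> B")
    case True
    have "card (B - assigned True h) \<le> Suc (card (B - insert x (assigned True h)))"
    proof -
      have "B - assigned True h \<subseteq> insert x (B - insert x (assigned True h))" by blast
      then have "card (B - assigned True h) \<le> card (insert x (B - insert x (assigned True h)))"
        using assms by (intro card_mono) auto
      also have "\<dots> \<le> Suc (card (B - insert x (assigned True h)))"
        using assms by (simp add: card_insert_if)
      finally show ?thesis .
    qed
    then have "\<gamma> ^ Suc (card (B - insert x (assigned True h))) \<le> \<gamma> ^ card (B - assigned True h)"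
      using \<gamma>_pos \<gamma>_less by (intro power_decreasing) auto
    then show ?thesis using True by (auto simp: hit_def)
  next
    case False
    then have "B - insert x (assigned True h) = B - assigned True h" by blast
    with False show ?thesis by (simp add: hit_def algebra_simps)
  qed
  with mono show "if free h m x
    then (1 - \<gamma>) * hit B (h @ [(m, x, False)]) + \<gamma> * hit B (h @ [(m, x, True)]) \<le> hit B h
    else hit B (h @ [(m, x, False)]) \<le> hit B h" by simp
qed

text \<open>While \<open>P i\<close> has no 1, every counted query is free: the answer 1 makes
  \<open>miss\<close> vanish, and the answer 0, of weight \<open>1 - \<gamma>\<close>, removes at
  most one factor \<open>1 - \<gamma>\<close>. Other queries never increase it.\<close>

lemma supermartingale_miss:
  assumes i: "i \<in> {1..k}" and W: "W \<subseteq> P i"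
  shows "supermartingale (miss i W n)"
  unfolding supermartingale_def
proof (intro allI)
  fix h m x
  let ?f = "\<lambda>(m, x, z::bool). x \<in> W \<and> x \<in> common_nbh V E (forced \<pi> True m)"
  let ?c = "length (filter ?f h)"
  show "if free h m x
    then (1 - \<gamma>) * miss i W n (h @ [(m, x, False)]) + \<gamma> * miss i W n (h @ [(m, x, True)])
      \<le> miss i W n h
    else miss i W n (h @ [(m, x, False)]) \<le> miss i W n h"
  proof (cases "P i \<inter> assigned True h = {}")
    case False
    then show ?thesis by (auto simp: miss_def)
  next
    case no_ones: True
    show ?thesis
    proof (cases "x \<in> W \<and> x \<in> common_nbh V E (forced \<pi> True m)")
      case True
      then have "x \<in> P i" using W by blast
      have "free h m x"
        using True no_ones block_unique[OF i _ \<open>x \<in> P i\<close>] by (auto simp: free_def)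
      moreover have "(1 - \<gamma>) * (1 - \<gamma>) ^ (n - Suc ?c) \<le> (1 - \<gamma>) ^ (n - ?c)"
        using power_decreasing[of "n - ?c" "Suc (n - Suc ?c)" "1 - \<gamma>"] \<gamma>_pos \<gamma>_less by simp
      ultimately show ?thesis using True no_ones \<open>x \<in> P i\<close> by (simp add: miss_def)
    next
      case False
      then have f: "filter ?f (h @ [(m, x, z)]) = filter ?f h" for z by auto
      have "miss i W n (h @ [(m, x, False)]) = miss i W n h"
        unfolding miss_def f by simp
      moreover have "miss i W n (h @ [(m, x, True)]) \<le> miss i W n h"
        unfolding miss_def f using \<gamma>_less by simp
      then have "\<gamma> * miss i W n (h @ [(m, x, True)]) \<le> \<gamma> * miss i W n h"
        using \<gamma>_pos by simp
      ultimately show ?thesis by (simp add: algebra_simps)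
    qed
  qed
qed

section \<open>Following a run of small potential to a falsified block\<close>

text \<open>The weighted average over the answers is at most \<open>G h\<close>, so some permitted
  answer keeps \<open>G\<close> below 1. All prefixes are recorded because the potential is later
  evaluated before the end of the run.\<close>

lemma descend:
  assumes G: "supermartingale G" and "G [] < 1"
  shows "\<exists>h m. run \<pi> root h m \<and> legal h \<and> m < length \<pi> \<and> snd (\<pi> ! m) = Initial
    \<and> (\<forall>n. G (take n h) < 1)"
proof -
  have "\<exists>h m. run \<pi> root h m \<and> legal h \<and> m < length \<pi> \<and> snd (\<pi> ! m) = Initial
    \<and> (\<forall>n. G (take n h) < 1)"
    if "run \<pi> root h m" "legal h" "\<forall>n. G (take n h) < 1" for h m
    using that
  proof (induction m arbitrary: h rule: less_induct)
    case (less m)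
    have m: "m < length \<pi>" using run_root_less less.prems(1) .
    show ?case
    proof (cases "snd (\<pi> ! m)")
      case Initial
      then show ?thesis using less.prems m by blast
    next
      case (Resolve i j x)
      have Gh: "G h < 1" using less.prems(3)[rule_format, of "length h"] by simp
      obtain z where z: "z \<longrightarrow> free h m x" "G (h @ [(m, x, z)]) < 1"
      proof (cases "G (h @ [(m, x, False)]) < 1")
        case True
        then show ?thesis using that[of False] by blast
      next
        case F: False
        note G' = G[unfolded supermartingale_def, rule_format, of h m x]
        have free: "free h m x" using G' F Gh by (auto split: if_splits)
        have "G (h @ [(m, x, True)]) < 1"
        proof (rule ccontr)
          assume "\<not> G (h @ [(m, x, True)]) < 1"
          then have "\<gamma> * 1 \<le> \<gamma> * G (h @ [(m, x, True)])" using \<gamma>_pos by simp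
          moreover have "(1 - \<gamma>) * 1 \<le> (1 - \<gamma>) * G (h @ [(m, x, False)])"
            using F \<gamma>_less by (intro mult_left_mono) auto
          ultimately show False using G' free Gh by simp
        qed
        with free show ?thesis using that[of True] by blast
      qed
      let ?c = "if z then j else i"
      have "?c < m" using resolveD[OF m Resolve] by simp
      moreover have "run \<pi> root (h @ [(m, x, z)]) ?c"
        using less.prems(1) Resolve by (auto simp: run_append)
      moreover have "legal (h @ [(m, x, z)])" using less.prems(2) z(1) legal_snoc by blast
      moreover have "\<forall>n. G (take n (h @ [(m, x, z)])) < 1"
      proof
        fix n
        show "G (take n (h @ [(m, x, z)])) < 1"
          using less.prems(3)[rule_format, of n] z(2) by (cases "n \<le> length h") auto
      qed
      ultimately show ?thesis by (rule less.IH)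
    qed
  qed
  from this[of "[]" root] assms(2) show ?thesis by simp
qed

text \<open>Every run to \<open>m\<close> sets \<open>u\<close> to 1. As variables are read once,
  \<open>u\<close> is not queried again from \<open>c\<close> on, so \<open>u\<close> is already
  forced at \<open>c\<close>, and freeness of \<open>v\<close> supplies the edge and the different
  block.\<close>

lemma edge_later:
  assumes run: "run \<pi> root (g @ (c, v, True) # g') m" and legal: "legal (g @ (c, v, True) # g')"
    and u: "u \<in> assigned True g" and clause: "Neg u \<in> fst (\<pi> ! m)"
  shows "{u, v} \<in> E" and "\<forall>i\<in>{1..k}. v \<in> P i \<longrightarrow> u \<notin> P i"
proof -
  have free: "free g c v" using legal by (simp add: legal_def)
  have "u \<notin> assigned True ((c, v, True) # g')"
    using run_assigned_disjoint[OF run] u by blast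
  moreover have "run \<pi> c ((c, v, True) # g') m" using run by (auto simp: run_append)
  moreover have "u \<in> forced \<pi> True m"
    using run_falsifies(2)[OF _ clause] by (simp add: forced_def)
  ultimately have "u \<in> forced \<pi> True c" using forced_later by blast
  then show "{u, v} \<in> E" using free by (auto simp: free_def common_nbh_def nbh_def)
  show "\<forall>i\<in>{1..k}. v \<in> P i \<longrightarrow> u \<notin> P i" using free u by (auto simp: free_def)
qed

text \<open>If an axiom on \<open>u\<close> and \<open>v\<close> were falsified,
  \<open>edge_later\<close>, applied to whichever was set last, would contradict its being an axiom.
  Only the block axioms remain.\<close>

lemma legal_sink:
  assumes run: "run \<pi> root h m" and legal: "legal h"
    and m: "m < length \<pi>" "snd (\<pi> ! m) = Initial"
  shows "\<exists>i\<in>{1..k}. fst (\<pi> ! m) = Pos ` P i"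
proof (rule ccontr)
  assume "\<not> ?thesis"
  with initialD[OF m] obtain u v where C: "fst (\<pi> ! m) = {Neg u, Neg v}" and "u \<noteq> v"
    and bad: "{u, v} \<notin> E \<or> (\<exists>i\<in>{1..k}. u \<in> P i \<and> v \<in> P i)"
    unfolding Clique_block_def by blast
  have "u \<in> assigned True h" "v \<in> assigned True h" using run_falsifies(2)[OF run] C by auto
  then obtain c where "(c, v, True) \<in> set h" by (auto simp: assigned_def)
  then obtain g g' where h: "h = g @ (c, v, True) # g'" by (meson split_list)
  with \<open>u \<in> assigned True h\<close> \<open>u \<noteq> v\<close> have "u \<in> assigned True g \<or> u \<in> assigned True g'" by auto
  then show False
  proof
    assume "u \<in> assigned True g"
    from edge_later[OF run[unfolded h] legal[unfolded h] this] bad C show False by blast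
  next
    assume "u \<in> assigned True g'"
    then obtain d where "(d, u, True) \<in> set g'" by (auto simp: assigned_def)
    then obtain f f' where "g' = f @ (d, u, True) # f'" by (meson split_list)
    then have h: "h = (g @ (c, v, True) # f) @ (d, u, True) # f'" using h by simp
    have "v \<in> assigned True (g @ (c, v, True) # f)" by simp
    from edge_later[OF run[unfolded h] legal[unfolded h] this] bad C
    show False by (auto simp: insert_commute)
  qed
qed

section \<open>A pair of nodes with a dense gap and few ones between\<close>

text \<open>By \<open>forced_later\<close>, every run from \<open>a\<close> to \<open>b\<close> sets
  all these vertices to 0, whichever way it goes.\<close>

definition gap :: "nat \<Rightarrow> nat \<Rightarrow> nat \<Rightarrow> 'a set" where
  "gap i a b = P i \<inter> forced \<pi> False b - forced \<pi> False a"

text \<open>The condition on \<open>b\<close> keeps \<open>miss\<close> from vanishing there; it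
  ranges over all runs to \<open>b\<close>, so that usefulness depends on the nodes alone.\<close>

definition useful :: "real \<Rightarrow> real \<Rightarrow> nat \<Rightarrow> nat \<Rightarrow> nat \<Rightarrow> bool" where
  "useful r q i a b \<longleftrightarrow> i \<in> {1..k} \<and> (\<forall>h. run \<pi> root h b \<longrightarrow> P i \<inter> assigned True h = {})
     \<and> nbh_dense V E r q (gap i a b)"

lemma nbh_dense_mono:
  assumes "nbh_dense V E r q W" "W \<subseteq> W'"
  shows "nbh_dense V E r q W'"
  unfolding nbh_dense_def nbh_dense_for_def
proof (intro allI impI)
  fix R assume "R \<subseteq> V" "real (card R) \<le> r"
  then have "q \<le> real (card (common_nbh V E R \<inter> W))"
    using assms(1) by (auto simp: nbh_dense_def nbh_dense_for_def)
  also have "\<dots> \<le> real (card (common_nbh V E R \<inter> W'))"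
    using assms(2) finite_V
    by (intro of_nat_mono card_mono) (auto simp: common_nbh_def intro: finite_subset)
  finally show "q \<le> real (card (common_nbh V E R \<inter> W'))" .
qed

text \<open>Otherwise each part has a bad set \<open>R j\<close>; the union of these has at most
  \<open>T * r\<close> elements and fewer than \<open>T * q\<close> common neighbours in the
  whole.\<close>

lemma nbh_dense_part:
  assumes dense: "nbh_dense V E (t * r) (t * q) (\<Union>j<T. W j)"
    and T: "0 < T" "real T \<le> t" and "0 < r" "0 < q"
  shows "\<exists>j<T. nbh_dense V E r q (W j)"
proof (rule ccontr)
  assume "\<not> ?thesis"
  then have "\<forall>j\<in>{..<T}. \<exists>R\<subseteq>V. real (card R) \<le> r \<and> real (card (common_nbh V E R \<inter> W j)) < q"
    by (fastforce simp: nbh_dense_def nbh_dense_for_def not_le)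
  then obtain R where R: "\<And>j. j < T \<Longrightarrow> R j \<subseteq> V" "\<And>j. j < T \<Longrightarrow> real (card (R j)) \<le> r"
    "\<And>j. j < T \<Longrightarrow> real (card (common_nbh V E (R j) \<inter> W j)) < q"
    unfolding bchoice_iff by (metis lessThan_iff)
  let ?R = "\<Union>j<T. R j"
  have "real (card ?R) \<le> (\<Sum>j<T. real (card (R j)))"
    using card_UN_le[of "{..<T}" R] by (simp flip: of_nat_sum)
  also have "\<dots> \<le> (\<Sum>j<T. r)" using R(2) by (intro sum_mono) auto
  also have "\<dots> \<le> t * r" using T(2) \<open>0 < r\<close> by (simp add: mult_right_mono)
  finally have "real (card ?R) \<le> t * r" .
  moreover have "?R \<subseteq> V" using R(1) by auto
  ultimately have "t * q \<le> real (card (common_nbh V E ?R \<inter> (\<Union>j<T. W j)))"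
    using dense by (simp only: nbh_dense_def nbh_dense_for_def)
  also have "\<dots> \<le> real (card (\<Union>j<T. common_nbh V E (R j) \<inter> W j))"
  proof (intro of_nat_mono card_mono)
    show "finite (\<Union>j<T. common_nbh V E (R j) \<inter> W j)"
      using finite_V by (auto simp: common_nbh_def)
  qed (auto simp: common_nbh_def)
  also have "\<dots> \<le> (\<Sum>j<T. real (card (common_nbh V E (R j) \<inter> W j)))"
    using card_UN_le[of "{..<T}" "\<lambda>j. common_nbh V E (R j) \<inter> W j"] by (simp flip: of_nat_sum)
  also have "\<dots> < (\<Sum>j<T. q)" using R(3) T(1) by (intro sum_strict_mono) auto
  also have "\<dots> \<le> t * q" using T(2) \<open>0 < q\<close> by (simp add: mult_right_mono)
  finally show False by simp
qed

text \<open>A legal history has at most one 1 per block, and none in block \<open>i\<close>.\<close>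

lemma card_ones_less:
  assumes "legal h" "i \<in> {1..k}" "P i \<inter> assigned True h = {}"
  shows "card (assigned True h) < k"
proof -
  have "\<forall>x\<in>assigned True h. \<exists>j\<in>{1..k}. x \<in> P j"
    using legal_ones[OF assms(1)] vertex_block by blast
  then obtain f where f: "\<And>x. x \<in> assigned True h \<Longrightarrow> f x \<in> {1..k} \<and> x \<in> P (f x)"
    by metis
  have "inj_on f (assigned True h)"
    using f legal_block_ones[OF assms(1)] by (metis inj_onI)
  moreover have "f ` assigned True h \<subseteq> {1..k} - {i}" using f assms(3) by blast
  ultimately have "card (assigned True h) \<le> card ({1..k} - {i})"
    by (intro card_inj_on_le) auto
  also have "\<dots> < k" using assms(2) by (simp add: card_Diff_singleton)
  finally show ?thesis .
qed

text \<open>The vertices of \<open>P i\<close> are sorted into \<open>T\<close> classes by the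
  number of ones set before their query. Some class is dense, and \<open>a\<close> and
  \<open>b\<close> are taken just before its first and just after its last query.\<close>

lemma useful_pair:
  assumes run: "run \<pi> root h m" and legal: "legal h"
    and i: "i \<in> {1..k}" and clause: "fst (\<pi> ! m) = Pos ` P i"
    and dense: "nbh_dense V E (t * r) (t * q) (P i)"
    and T: "0 < T" "real T \<le> t" and "0 < r" "0 < q"
  shows "\<exists>g g' g'' a b. h = g @ g' @ g'' \<and> run \<pi> root g a \<and> run \<pi> a g' b
    \<and> useful r q i a b \<and> card (assigned True g') * T < k"
proof -
  have zeros: "P i \<subseteq> assigned False h'" if "run \<pi> root h' m" for h'
    using run_falsifies(1)[OF that] clause by blast
  then have forced_m: "P i \<subseteq> forced \<pi> False m" by (auto simp: forced_def)
  have no_ones: "P i \<inter> assigned True h' = {}" if "run \<pi> root h' m" for h'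
    using zeros[OF that] run_consistent[OF that] by blast
  define ones where "ones n = card (assigned True (take n h))" for n
  have ones_less: "ones n < k" for n
  proof -
    have "assigned True (take n h) \<subseteq> assigned True h"
      by (metis append_take_drop_id assigned_append sup_ge1)
    then have "ones n \<le> card (assigned True h)" unfolding ones_def by (simp add: card_mono)
    then show ?thesis using card_ones_less[OF legal i no_ones[OF run]] by simp
  qed
  have "\<forall>v\<in>P i. \<exists>n<length h. \<exists>c. h ! n = (c, v, False)"
    using zeros[OF run] by (fastforce simp: assigned_def in_set_conv_nth)
  then obtain idx where idx: "\<And>v. v \<in> P i \<Longrightarrow> idx v < length h"
    "\<And>v. v \<in> P i \<Longrightarrow> \<exists>c. h ! idx v = (c, v, False)"
    by metis
  \<comment> \<open>Class \<open>j\<close> holds the vertices queried when the number of ones is at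
    least \<open>j * k / T\<close> and less than \<open>(j + 1) * k / T\<close>. As there are fewer
    than \<open>k\<close> ones, \<open>T\<close> classes suffice.\<close>
  define W where "W j = {v \<in> P i. ones (idx v) * T div k = j}" for j
  have "(\<Union>j<T. W j) = P i"
    using ones_less T(1) by (auto simp: W_def intro!: less_mult_imp_div_less)
  with dense have "nbh_dense V E (t * r) (t * q) (\<Union>j<T. W j)" by simp
  from nbh_dense_part[OF this T \<open>0 < r\<close> \<open>0 < q\<close>] obtain j where j: "nbh_dense V E r q (W j)"
    by blast
  have "W j \<noteq> {}"
  proof
    assume "W j = {}"
    then have "q \<le> 0" using j \<open>0 < r\<close> unfolding nbh_dense_def nbh_dense_for_def
      by (auto dest!: spec[of _ "{}"])
    then show False using \<open>0 < q\<close> by simp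
  qed
  moreover have finW: "finite (W j)"
    using finite_subset[OF block_subset[OF i] finite_V] by (simp add: W_def)
  ultimately have "Min (idx ` W j) \<in> idx ` W j" "Max (idx ` W j) \<in> idx ` W j" by auto
  then obtain w1 w2 where w: "w1 \<in> W j" "w2 \<in> W j"
    and w1: "idx w1 = Min (idx ` W j)" and w2: "idx w2 = Max (idx ` W j)" by (metis imageE)
  have W_idx: "idx w1 \<le> idx v \<and> idx v \<le> idx w2" if "v \<in> W j" for v
    using that finW by (simp add: w1 w2)
  define g where "g = take (idx w1) h"
  \<comment> \<open>\<open>Suc\<close> includes the query of \<open>w2\<close>, so that the whole
    class is set before \<open>b\<close>.\<close>
  define g' where "g' = drop (idx w1) (take (Suc (idx w2)) h)"
  define g'' where "g'' = drop (Suc (idx w2)) h"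
  have le: "idx w1 \<le> idx w2" using W_idx w by blast
  have "take (idx w1) (take (Suc (idx w2)) h) = g" using le by (simp add: g_def min_def)
  then have gg': "g @ g' = take (Suc (idx w2)) h"
    unfolding g'_def by (metis append_take_drop_id)
  then have h: "h = g @ g' @ g''" unfolding g''_def by (metis append_assoc append_take_drop_id)
  from run obtain a b where a: "run \<pi> root g a" and b: "run \<pi> a g' b" and m: "run \<pi> b g'' m"
    unfolding h run_append by blast
  \<comment> \<open>Read-once in both directions: a vertex set before \<open>b\<close> is not set
    after it, so being forced at \<open>m\<close> it is forced at \<open>b\<close>; a vertex set
    after \<open>a\<close> is not set before, so it is not forced at \<open>a\<close>.\<close>
  have "W j \<subseteq> gap i a b"
  proof
    fix v assume v: "v \<in> W j"
    then have vP: "v \<in> P i" by (simp add: W_def)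
    obtain c where c: "h ! idx v = (c, v, False)" using idx(2)[OF vP] by blast
    have "take (Suc (idx w2)) h ! idx v = (c, v, False)"
      and "idx v < length (take (Suc (idx w2)) h)"
      using W_idx[OF v] idx(1)[OF vP] c by auto
    then have "(c, v, False) \<in> set (g @ g')" unfolding gg' by (metis nth_mem)
    then have "v \<in> assigned False (g @ g')" unfolding assigned_def by blast
    moreover have "assigned False (g @ g') \<inter> assigned False g'' = {}"
      using run h by (intro run_assigned_disjoint) simp
    ultimately have "v \<in> forced \<pi> False b" using forced_later[OF m] forced_m vP by blast
    moreover have "v \<notin> forced \<pi> False a"
    proof
      assume "v \<in> forced \<pi> False a"
      then have "v \<in> assigned False g" using forcedD[OF _ a] by blast
      moreover have "(c, v, False) \<in> set (drop (idx w1) h)"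
        using c W_idx[OF v] idx(1)[OF vP]
        by (auto simp: in_set_conv_nth intro!: exI[of _ "idx v - idx w1"])
      then have "v \<in> assigned False (drop (idx w1) h)" unfolding assigned_def by blast
      moreover have "assigned False g \<inter> assigned False (drop (idx w1) h) = {}"
        using run unfolding g_def by (intro run_assigned_disjoint) simp
      ultimately show False by blast
    qed
    ultimately show "v \<in> gap i a b" using vP by (simp add: gap_def)
  qed
  moreover have "P i \<inter> assigned True h' = {}" if "run \<pi> root h' b" for h'
  proof -
    have "run \<pi> root (h' @ g'') m" using that m run_append by blast
    from no_ones[OF this] show ?thesis by auto
  qed
  ultimately have useful: "useful r q i a b"
    using i nbh_dense_mono[OF j] by (simp add: useful_def)
  \<comment> \<open>The last query of \<open>g'\<close> is answered 0 and adds no one.\<close>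
  have "assigned True (g @ g') = assigned True (take (idx w2) h)"
  proof -
    have w2P: "w2 \<in> P i" using w(2) by (simp add: W_def)
    obtain c where "h ! idx w2 = (c, w2, False)" using idx(2)[OF w2P] by blast
    then have "take (Suc (idx w2)) h = take (idx w2) h @ [(c, w2, False)]"
      using idx(1)[OF w2P] by (simp add: take_Suc_conv_app_nth)
    then show ?thesis unfolding gg' by simp
  qed
  moreover have "assigned True g \<inter> assigned True g' = {}"
    using run_assigned_disjoint[of g g' b] a b run_append by blast
  ultimately have "ones (idx w2) = ones (idx w1) + card (assigned True g')"
    unfolding ones_def by (metis assigned_append card_Un_disjoint finite_assigned g_def)
  moreover have "ones (idx w1) * T div k = j" "ones (idx w2) * T div k = j"
    using w by (auto simp: W_def)
  \<comment> \<open>Adding \<open>d\<close> ones with \<open>k \<le> d * T\<close> would lead out of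
    class \<open>j\<close>, but both ends lie in it.\<close>
  moreover have "j < (ones (idx w1) + d) * T div k" if "k \<le> d * T" for d
  proof -
    have "j < (ones (idx w1) * T + k) div k"
      using \<open>ones (idx w1) * T div k = j\<close> ones_less[of 0] by simp
    also have "\<dots> \<le> (ones (idx w1) + d) * T div k"
      using that by (intro div_le_mono) (simp add: distrib_right)
    finally show ?thesis .
  qed
  ultimately have "card (assigned True g') * T < k" by (metis less_irrefl not_less)
  with useful a b h show ?thesis by blast
qed

section \<open>The potential of a fixed pair of nodes\<close>

text \<open>Each assumption on \<open>\<delta>\<close> pays for one event: many ones forced at
  \<open>a\<close>, at least \<open>r\<close> ones in \<open>S\<close>, or at least
  \<open>q'\<close> free queries without a one in the block. The potentials of the last two are
  added, whence \<open>2 * \<delta>\<close>.\<close>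

lemma pair_potential:
  assumes mostly: "\<And>W. W \<subseteq> V \<Longrightarrow> nbh_dense V E r q W \<Longrightarrow> mostly_nbh_dense V E r' r q' s W"
    and "0 < r" "0 < s" "s * \<gamma> \<le> 1"
    and \<delta>: "\<gamma> powr (r' / 2) \<le> \<delta>" "(s * \<gamma>) powr r \<le> \<delta>" "(1 - \<gamma>) powr q' \<le> \<delta>"
  shows "\<exists>G. supermartingale G \<and> (\<forall>h. 0 \<le> G h) \<and> G [] \<le> 2 * \<delta> \<and>
    (\<forall>g h i. run \<pi> root g a \<and> run \<pi> a h b \<and> legal (g @ h) \<and> useful r q i a b
       \<and> real (card (assigned True h)) \<le> r' / 2 \<longrightarrow> 1 \<le> G (g @ h))"
proof (cases "\<exists>i g. useful r q i a b \<and> run \<pi> root g a")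
  case False
  have "0 \<le> \<delta>" using \<delta>(1) powr_ge_zero order_trans by blast
  with False show ?thesis using supermartingale_zero by (intro exI[of _ "\<lambda>h. 0"]) auto
next
  case True
  \<comment> \<open>One index is fixed for the pair. The bound on \<open>G (g @ h)\<close> does not
    mention the index, so this potential serves every useful index.\<close>
  then obtain i g0 where i: "useful r q i a b" and g0: "run \<pi> root g0 a" by blast
  define B where "B = forced \<pi> True a"
  have "B \<subseteq> assigned True g0" using forcedD[OF _ g0] by (auto simp: B_def)
  then have finB: "finite B" by (rule finite_subset) simp
  have B_ones: "B \<subseteq> assigned True g" if "run \<pi> root g a" for g
    using forcedD[OF _ that] by (auto simp: B_def)
  have \<delta>0: "0 \<le> \<delta>" using \<delta>(1) powr_ge_zero order_trans by blast
  have hit_one: "hit B' h = 1" if "run \<pi> root h c" "B' \<subseteq> assigned True h" for B' h c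
  proof -
    have "B' \<inter> assigned False h = {}" "B' - assigned True h = {}"
      using run_consistent[OF that(1)] that(2) by blast+
    then show ?thesis unfolding hit_def by (simp only: card.empty power_0 if_True simp_thms)
  qed
  show ?thesis
  proof (cases "real (card B) \<le> r' / 2")
    case False
    \<comment> \<open>More than \<open>r' / 2\<close> ones are forced at \<open>a\<close>, and every
      run through \<open>a\<close> hits all of them.\<close>
    have "hit B [] = \<gamma> powr real (card B)" using \<gamma>_pos by (simp add: hit_def powr_realpow)
    also have "\<dots> \<le> \<gamma> powr (r' / 2)"
      using False \<gamma>_pos \<gamma>_less by (intro powr_mono') auto
    finally have "hit B [] \<le> 2 * \<delta>" using \<delta>(1) \<delta>0 by linarith
    moreover have "1 \<le> hit B (g @ h)" if "run \<pi> root g a" "run \<pi> a h b" for g h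
    proof -
      have "run \<pi> root (g @ h) b" using that run_append by blast
      then show ?thesis using hit_one B_ones[OF that(1)] by (simp add: le_supI1)
    qed
    ultimately show ?thesis
      using supermartingale_hit[OF finB] hit_nonneg by (intro exI[of _ "hit B"]) blast
  next
    case card_B: True
    have ik: "i \<in> {1..k}" using i by (simp add: useful_def)
    let ?W = "gap i a b"
    have WP: "?W \<subseteq> P i" by (auto simp: gap_def)
    have "mostly_nbh_dense V E r' r q' s ?W"
      using WP block_subset[OF ik] i by (intro mostly) (auto simp: useful_def)
    then obtain S where S: "S \<subseteq> V" "real (card S) \<le> s"
      and few: "\<And>R. R \<subseteq> V \<Longrightarrow> real (card R) \<le> r' \<Longrightarrow> \<not> nbh_dense_for V E q' ?W R \<Longrightarrow>
        r \<le> real (card (R \<inter> S))"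
      unfolding mostly_nbh_dense_def by metis
    have finS: "finite S" using S(1) finite_V finite_subset by blast
    \<comment> \<open>Exponents must be natural. Rounding up only lowers the initial values, as the
      bases are at most 1, and a count that reaches \<open>r\<close> or \<open>q'\<close> also
      reaches the rounded threshold.\<close>
    define \<rho> where "\<rho> = nat \<lceil>r\<rceil>"
    define n where "n = nat \<lceil>q'\<rceil>"
    define \<B> where "\<B> = {B'. B' \<subseteq> S \<and> card B' = \<rho>}"
    have fin\<B>: "finite \<B>" using finS by (simp add: \<B>_def)
    define G where "G h = (\<Sum>B'\<in>\<B>. hit B' h) + miss i ?W n h" for h
    have "supermartingale G"
      unfolding G_def using fin\<B> finS ik WP
      by (intro supermartingale_add supermartingale_sum supermartingale_hit supermartingale_miss)
        (auto simp: \<B>_def intro: finite_subset)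
    moreover have "0 \<le> G h" for h
      unfolding G_def by (intro add_nonneg_nonneg sum_nonneg hit_nonneg miss_nonneg)
    moreover have "G [] \<le> 2 * \<delta>"
    proof -
      have "(\<Sum>B'\<in>\<B>. hit B' []) = (\<Sum>B'\<in>\<B>. \<gamma> ^ \<rho>)"
        by (intro sum.cong) (auto simp: \<B>_def hit_def)
      also have "\<dots> = real (card S choose \<rho>) * \<gamma> ^ \<rho>"
        using n_subsets[OF finS] by (simp add: \<B>_def)
      also have "\<dots> \<le> real (card S) ^ \<rho> * \<gamma> ^ \<rho>"
      proof (cases "\<rho> \<le> card S")
        case True
        then have "real (card S choose \<rho>) \<le> real (card S ^ \<rho>)"
          using binomial_le_pow of_nat_mono by blast
        then show ?thesis using \<gamma>_pos by (intro mult_right_mono) auto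
      next
        case False
        then show ?thesis using \<gamma>_pos by (simp add: binomial_eq_0)
      qed
      also have "\<dots> \<le> (s * \<gamma>) ^ \<rho>"
        using S(2) \<gamma>_pos by (simp add: power_mult_distrib mult_right_mono power_mono)
      also have "\<dots> = (s * \<gamma>) powr real \<rho>" using \<gamma>_pos \<open>0 < s\<close> by (simp add: powr_realpow)
      also have "\<dots> \<le> (s * \<gamma>) powr r"
        using \<open>s * \<gamma> \<le> 1\<close> \<gamma>_pos \<open>0 < s\<close> real_nat_ceiling_ge unfolding \<rho>_def
        by (intro powr_mono') simp_all
      finally have "(\<Sum>B'\<in>\<B>. hit B' []) \<le> \<delta>" using \<delta>(2) by linarith
      moreover have "miss i ?W n [] = (1 - \<gamma>) powr real n"
        using \<gamma>_less by (simp add: miss_def powr_realpow)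
      moreover have "\<dots> \<le> (1 - \<gamma>) powr q'"
        using \<gamma>_pos \<gamma>_less unfolding n_def by (intro powr_mono') linarith+
      ultimately show ?thesis using \<delta>(3) unfolding G_def by linarith
    qed
    moreover have "1 \<le> G (g @ h)"
      if g: "run \<pi> root g a" and h: "run \<pi> a h b" and legal: "legal (g @ h)"
        and card_h: "real (card (assigned True h)) \<le> r' / 2" for g h
    proof -
      have gh: "run \<pi> root (g @ h) b" using g h run_append by blast
      \<comment> \<open>By \<open>forced_later\<close>, the ones forced at any node along
        \<open>h\<close> lie in \<open>?R\<close>, independently of \<open>g\<close>.\<close>
      let ?R = "B \<union> assigned True h"
      have R_ones: "?R \<subseteq> assigned True (g @ h)" using B_ones[OF g] by auto
      then have RV: "?R \<subseteq> V" using legal_ones[OF legal] by blast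
      have "card ?R \<le> card B + card (assigned True h)" by (rule card_Un_le)
      then have card_R: "real (card ?R) \<le> r'" using card_B card_h by linarith
      show ?thesis
      proof (cases "nbh_dense_for V E q' ?W ?R")
        case True
        let ?f = "\<lambda>(m, x, z::bool). x \<in> ?W \<and> x \<in> common_nbh V E (forced \<pi> True m)"
        \<comment> \<open>Vertices of the gap are queried in \<open>h\<close>; the ones forced at
          that node lie in \<open>?R\<close>, so common neighbours of \<open>?R\<close> are counted
          by \<open>miss\<close>.\<close>
        have "common_nbh V E ?R \<inter> ?W \<subseteq> (fst \<circ> snd) ` set (filter ?f (g @ h))"
        proof
          fix x assume x: "x \<in> common_nbh V E ?R \<inter> ?W"
          then have "x \<in> assigned False h"
            using forced_later[OF h] by (auto simp: gap_def)
          then obtain c where "(c, x, False) \<in> set h" by (auto simp: assigned_def)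
          then obtain f f' where f: "h = f @ (c, x, False) # f'" by (meson split_list)
          then have "run \<pi> a f c" using h by (auto simp: run_append)
          then have "forced \<pi> True c \<subseteq> ?R"
            using forced_later f unfolding B_def by fastforce
          then have "x \<in> common_nbh V E (forced \<pi> True c)"
            using x by (auto simp: common_nbh_def)
          then have "(c, x, False) \<in> set (filter ?f (g @ h))" using x f by auto
          then show "x \<in> (fst \<circ> snd) ` set (filter ?f (g @ h))" by force
        qed
        then have "card (common_nbh V E ?R \<inter> ?W) \<le> card ((fst \<circ> snd) ` set (filter ?f (g @ h)))"
          by (intro card_mono) auto
        also have "\<dots> \<le> length (filter ?f (g @ h))"
          by (meson card_image_le card_length finite_set le_trans)
        finally have "q' \<le> real (length (filter ?f (g @ h)))"
          using True unfolding nbh_dense_for_def by linarith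
        then have "n \<le> length (filter ?f (g @ h))" unfolding n_def by linarith
        moreover have "P i \<inter> assigned True (g @ h) = {}"
          using i gh unfolding useful_def by blast
        ultimately have "miss i ?W n (g @ h) = 1" unfolding miss_def by simp
        then show ?thesis unfolding G_def by (simp add: sum_nonneg hit_nonneg)
      next
        case False
        \<comment> \<open>Any \<open>\<rho>\<close> of these vertices form a member of
          \<open>\<B>\<close> that the run sets to 1 entirely.\<close>
        then have "r \<le> real (card (?R \<inter> S))" using few RV card_R by blast
        then have "\<rho> \<le> card (?R \<inter> S)" unfolding \<rho>_def by linarith
        then obtain B' where B': "B' \<subseteq> ?R \<inter> S" "card B' = \<rho>"
          by (metis obtain_subset_with_card_n)
        then have "hit B' (g @ h) = 1" using hit_one[OF gh] R_ones by blast
        moreover have "hit B' (g @ h) \<le> (\<Sum>B'\<in>\<B>. hit B' (g @ h))"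
          using B' fin\<B> hit_nonneg by (intro member_le_sum) (auto simp: \<B>_def)
        ultimately show ?thesis using miss_nonneg[of i ?W n "g @ h"] unfolding G_def by linarith
      qed
    qed
    ultimately show ?thesis by (intro exI[of _ G]) blast
  qed
qed

section \<open>Union bound over all pairs of nodes\<close>

text \<open>If the sum of all pair potentials started below 1, it would stay below 1 along some run
  to a falsified block, although the useful pair on that run contributes at least 1.\<close>

lemma length_bound:
  assumes blocks: "\<And>i. i \<in> {1..k} \<Longrightarrow> nbh_dense V E (t * r) (t * q) (P i)"
    and mostly: "\<And>W. W \<subseteq> V \<Longrightarrow> nbh_dense V E r q W \<Longrightarrow> mostly_nbh_dense V E (t * r) r q' s W"
    and "1 \<le> t" "0 < r" "0 < q" "4 * real k / t\<^sup>2 \<le> r" "0 < s" "s * \<gamma> \<le> 1"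
    and \<delta>: "\<gamma> powr (t * r / 2) \<le> \<delta>" "(s * \<gamma>) powr r \<le> \<delta>" "(1 - \<gamma>) powr q' \<le> \<delta>"
  shows "1 \<le> 2 * \<delta> * (real (length \<pi>))\<^sup>2"
proof (rule ccontr)
  assume small: "\<not> ?thesis"
  have "\<forall>e. \<exists>G. supermartingale G \<and> (\<forall>h. 0 \<le> G h) \<and> G [] \<le> 2 * \<delta> \<and>
    (\<forall>g h i. run \<pi> root g (fst e) \<and> run \<pi> (fst e) h (snd e) \<and> legal (g @ h)
       \<and> useful r q i (fst e) (snd e)
       \<and> real (card (assigned True h)) \<le> t * r / 2 \<longrightarrow> 1 \<le> G (g @ h))"
    by (intro allI pair_potential[OF mostly \<open>0 < r\<close> \<open>0 < s\<close> \<open>s * \<gamma> \<le> 1\<close> \<delta>])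
  then obtain G where G: "\<And>e. supermartingale (G e)" "\<And>e h. 0 \<le> G e h" "\<And>e. G e [] \<le> 2 * \<delta>"
    and G1: "\<And>a b g h i. \<lbrakk>run \<pi> root g a; run \<pi> a h b; legal (g @ h); useful r q i a b;
       real (card (assigned True h)) \<le> t * r / 2\<rbrakk> \<Longrightarrow> 1 \<le> G (a, b) (g @ h)"
    unfolding choice_iff by force
  let ?I = "{..<length \<pi>} \<times> {..<length \<pi>}"
  define H where "H h = (\<Sum>e\<in>?I. G e h)" for h
  have "supermartingale H" unfolding H_def using G(1) by (intro supermartingale_sum) auto
  moreover have "H [] < 1"
  proof -
    have "H [] \<le> (\<Sum>e\<in>?I. 2 * \<delta>)" unfolding H_def using G(3) by (intro sum_mono) auto
    also have "\<dots> = 2 * \<delta> * (real (length \<pi>))\<^sup>2"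
      by (simp add: card_cartesian_product power2_eq_square)
    finally show ?thesis using small by simp
  qed
  ultimately obtain h m where h: "run \<pi> root h m" "legal h" "m < length \<pi>"
    "snd (\<pi> ! m) = Initial" and H: "\<And>n. H (take n h) < 1"
    using descend by blast
  obtain i where i: "i \<in> {1..k}" "fst (\<pi> ! m) = Pos ` P i" using legal_sink[OF h] by blast
  define T where "T = nat \<lfloor>t\<rfloor>"
  have T: "0 < T" "real T \<le> t" using \<open>1 \<le> t\<close> unfolding T_def by linarith+
  have "t < real T + 1" unfolding T_def by linarith
  moreover have "1 \<le> real T" using T(1) by simp
  ultimately have "t / 2 \<le> real T" by linarith
  from useful_pair[OF h(1,2) i blocks[OF i(1)] T(1,2) \<open>0 < r\<close> \<open>0 < q\<close>]
  obtain g g' g'' a b where d: "h = g @ g' @ g''" "run \<pi> root g a" "run \<pi> a g' b"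
    "useful r q i a b" "card (assigned True g') * T < k" by blast
  \<comment> \<open>Rounding \<open>t\<close> down loses at most a factor 2: fewer than
    \<open>k / T \<le> 2 * k / t\<close> ones lie between \<open>a\<close> and \<open>b\<close>, and
    the lower bound on \<open>r\<close> makes this at most \<open>t * r / 2\<close>.\<close>
  have "real (card (assigned True g')) * (t / 2) \<le> real (card (assigned True g')) * real T"
    using \<open>t / 2 \<le> real T\<close> by (intro mult_left_mono) auto
  also have "\<dots> < real k" using d(5) by (simp flip: of_nat_mult)
  also have "real k \<le> r * t\<^sup>2 / 4"
    using \<open>4 * real k / t\<^sup>2 \<le> r\<close> \<open>1 \<le> t\<close> by (simp add: field_simps)
  also have "\<dots> = t * r / 2 * (t / 2)" by (simp add: power2_eq_square)
  finally have "real (card (assigned True g')) \<le> t * r / 2"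
    using \<open>1 \<le> t\<close> by (simp add: mult_less_cancel_right mult.commute)
  moreover have "legal (g @ g')" using h(2) d(1) legal_appendD[of "g @ g'" g''] by simp
  ultimately have "1 \<le> G (a, b) (g @ g')" using G1 d by blast
  moreover have "run \<pi> root (g @ g') b" using d run_append by blast
  then have "(a, b) \<in> ?I" using run_root_less d(2) by blast
  then have "G (a, b) (g @ g') \<le> H (g @ g')"
    unfolding H_def using G(2) by (intro member_le_sum) auto
  moreover have "take (length (g @ g')) h = g @ g'" using d(1) by simp
  ultimately show False using H[of "length (g @ g')"] by simp
qed

end

section \<open>Choice of the parameters\<close>

theorem theorem5p5:
  "\<exists>c>0. \<forall>(k::nat) (t::real) (s::real) (\<epsilon>::real) (V::'a set) E P.
     0 < k \<and> 0 < t \<and> 0 < s \<and> 0 < \<epsilon> \<and>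
     simple_graph V E \<and> k_partition k V P \<and> balanced k P \<and>
     clique_dense k t s \<epsilon> V E P \<longrightarrow>
     (\<forall>\<pi>. resolution_refutation (Clique_block k V E P) \<pi> \<and> regular \<pi> \<longrightarrow>
        real (length \<pi>) \<ge> c * s powr (\<epsilon> * real k / t\<^sup>2))"
proof (intro exI[of _ "1 / 2"] conjI allI impI)
  fix k :: nat and t s \<epsilon> :: real and V :: "'a set" and E P \<pi>
  assume A: "0 < k \<and> 0 < t \<and> 0 < s \<and> 0 < \<epsilon> \<and> simple_graph V E \<and> k_partition k V P \<and>
      balanced k P \<and> clique_dense k t s \<epsilon> V E P"
    and \<pi>: "resolution_refutation (Clique_block k V E P) \<pi> \<and> regular \<pi>"
  have len: "1 \<le> real (length \<pi>)"
    using \<pi> by (cases \<pi>) (auto simp: resolution_refutation_def)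
  let ?X = "s powr (\<epsilon> * real k / t\<^sup>2)"
  show "1 / 2 * ?X \<le> real (length \<pi>)"
  \<comment> \<open>For \<open>s \<le> 1\<close> the choice of \<open>\<gamma>\<close> would not be
    below 1, but the bound is trivial then.\<close>
  proof (cases "1 < s")
    case False
    then have "?X \<le> 1" using A powr_le1[of "\<epsilon> * real k / t\<^sup>2" s] by simp
    then show ?thesis using len by simp
  next
    case s: True
    define \<gamma> where "\<gamma> = s powr - (1 + \<epsilon>)"
    have \<gamma>: "0 < \<gamma>" "\<gamma> < 1"
      using s A powr_less_mono[of "- (1 + \<epsilon>)" 0 s] by (auto simp: \<gamma>_def)
    interpret clique_refutation k V E P \<pi> \<gamma>
      using A \<pi> \<gamma> by unfold_locales auto
    from A obtain r q where t: "1 \<le> t" and rq: "0 < r" "0 < q" "4 * real k / t\<^sup>2 \<le> r"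
      and blocks: "\<And>i. i \<in> {1..k} \<Longrightarrow> nbh_dense V E (t * r) (t * q) (P i)"
      and mostly: "\<And>W. W \<subseteq> V \<Longrightarrow> nbh_dense V E r q W \<Longrightarrow>
        mostly_nbh_dense V E (t * r) r (\<epsilon> * r * s powr (1 + \<epsilon>) * ln s) s W"
      unfolding clique_dense_def by blast
    \<comment> \<open>A common bound for the three events, chosen so that
      \<open>4 * real k / t\<^sup>2 \<le> r\<close> yields
      \<open>?X\<^sup>2 * \<delta> \<le> 1\<close>.\<close>
    define \<delta> where "\<delta> = s powr - (\<epsilon> * r / 2)"
    have s\<gamma>: "s * \<gamma> = s powr - \<epsilon>"
      using s powr_add[of s 1 "- (1 + \<epsilon>)"] by (simp add: \<gamma>_def)
    have "r / 2 * \<epsilon> \<le> t * r / 2 * (1 + \<epsilon>)"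
      using t rq A by (intro mult_mono) auto
    then have \<delta>1: "\<gamma> powr (t * r / 2) \<le> \<delta>"
      using s unfolding \<gamma>_def \<delta>_def powr_powr by (intro powr_mono) (auto simp: algebra_simps)
    have \<delta>2: "(s * \<gamma>) powr r \<le> \<delta>"
      using s A rq unfolding s\<gamma> \<delta>_def powr_powr by (intro powr_mono) auto
    \<comment> \<open>By \<open>ln (1 - \<gamma>) \<le> - \<gamma>\<close>; the factor
      \<open>s powr (1 + \<epsilon>)\<close> of the density then cancels
      \<open>\<gamma>\<close>.\<close>
    have "(1 - \<gamma>) powr (\<epsilon> * r * s powr (1 + \<epsilon>) * ln s)
        = exp (\<epsilon> * r * s powr (1 + \<epsilon>) * ln s * ln (1 - \<gamma>))"
      using \<gamma> by (simp add: powr_def)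
    also have "\<dots> \<le> exp (\<epsilon> * r * s powr (1 + \<epsilon>) * ln s * (- \<gamma>))"
      using ln_le_minus_one[of "1 - \<gamma>"] \<gamma> s A rq unfolding exp_le_cancel_iff
      by (intro mult_left_mono) auto
    also have "\<epsilon> * r * s powr (1 + \<epsilon>) * ln s * (- \<gamma>) = - (\<epsilon> * r) * ln s * (s powr (1 + \<epsilon>) * \<gamma>)"
      by (simp add: algebra_simps)
    also have "s powr (1 + \<epsilon>) * \<gamma> = 1"
      using s by (simp add: \<gamma>_def flip: powr_add)
    also have "exp (- (\<epsilon> * r) * ln s * 1) = s powr - (\<epsilon> * r)"
      using s by (simp add: powr_def)
    also have "\<dots> \<le> \<delta>"
      using s A rq unfolding \<delta>_def by (intro powr_mono) auto
    finally have \<delta>3: "(1 - \<gamma>) powr (\<epsilon> * r * s powr (1 + \<epsilon>) * ln s) \<le> \<delta>" .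
    have "s * \<gamma> \<le> 1"
      using s A powr_mono[of "- \<epsilon>" 0 s] by (simp add: s\<gamma>)
    from length_bound[OF blocks mostly t rq _ this \<delta>1 \<delta>2 \<delta>3]
    have "1 \<le> 2 * \<delta> * (real (length \<pi>))\<^sup>2" using s by simp
    moreover have "?X\<^sup>2 * \<delta> \<le> 1"
    proof -
      have "?X\<^sup>2 * \<delta> = s powr (2 * (\<epsilon> * real k / t\<^sup>2) - \<epsilon> * r / 2)"
        using s by (simp add: \<delta>_def power2_eq_square flip: powr_add)
      also have "\<dots> \<le> s powr 0"
      proof (rule powr_mono)
        have "\<epsilon> * (4 * real k / t\<^sup>2) \<le> \<epsilon> * r" using rq(3) A by (intro mult_left_mono) auto
        then show "2 * (\<epsilon> * real k / t\<^sup>2) - \<epsilon> * r / 2 \<le> 0" by (simp add: mult.left_commute)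
      qed (use s in simp)
      finally show ?thesis using s by simp
    qed
    ultimately have "?X\<^sup>2 * 1 \<le> ?X\<^sup>2 * (2 * \<delta> * (real (length \<pi>))\<^sup>2)"
      by (intro mult_left_mono) auto
    also have "\<dots> = (?X\<^sup>2 * \<delta>) * (2 * (real (length \<pi>))\<^sup>2)" by simp
    also have "\<dots> \<le> 1 * (2 * (real (length \<pi>))\<^sup>2)"
      using \<open>?X\<^sup>2 * \<delta> \<le> 1\<close> by (rule mult_right_mono) simp
    \<comment> \<open>The factor 2 is enlarged to 4 to obtain a square; this gives the constant
      \<open>1 / 2\<close>.\<close>
    also have "\<dots> \<le> (2 * real (length \<pi>))\<^sup>2" by (simp add: power_mult_distrib)
    finally have "?X\<^sup>2 \<le> (2 * real (length \<pi>))\<^sup>2" by simp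
    then have "?X \<le> 2 * real (length \<pi>)" by (rule power2_le_imp_le) simp
    then show ?thesis by simp
  qed
qed simp

end
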